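(* Let $\Lambda$ be a $k$-graph. For every $i\in\{1,\dots,k\}$ and every $e\in\Lambda^{\varepsilon_i}$, $$\mathsf{E}(\mathrm{r}(e))\supseteq\{i\}\cup\mathsf{E}(\mathrm{s}(e)).$$
   Context: Let $\mathbb{N}^k$ be the free abelian monoid with generators $\varepsilon_1,\dots,\varepsilon_k$ (with $0\in\mathbb{N}$). A $k$-graph is a countable category $\Lambda$ together with a functor $d\colon\Lambda\to\mathbb{N}^k$ satisfying the factorisation property: whenever $d(\lambda)=m+n$ there exist unique $\mu,\nu\in\Lambda$ with $d(\mu)=m$, $d(\nu)=n$ and $\lambda=\mu\nu$. Elements of $\Lambda$ are morphisms; $\mathrm{r},\mathrm{s}\colon\Lambda\to\Lambda^0$ are the range and source maps; $\Lambda^m:=d^{-1}(m)$, and $\Lambda^0=d^{-1}(0)$ is identified with the set of objects (vertices). The composite $\mu\nu$ is defined when $\mathrm{s}(\mu)=\mathrm{r}(\nu)$, and then $\mathrm{r}(\mu\nu)=\mathrm{r}(\mu)$, $\mathrm{s}(\mu\nu)=\mathrm{s}(\nu)$. Elements of $\Lambda^{\varepsilon_i}$ are edges of colour $i$. For $v\in\Lambda^0$ and $F\subseteq\Lambda$, $vF=\mathrm{r}^{-1}(v)\cap F$. For $v\in\Lambda^0$, $\mathsf{E}(v)=\{i\in\{1,\dots,k\}: v\Lambda^{\varepsilon_i}\neq\emptyset\}$, the set of colours $i$ for which there is a colour-$i$ edge with range $v$. *)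

theory Defs
  imports "HOL-Library.Poly_Mapping" "HOL-Library.Countable_Set"
begin

text \<open>
  A small category together with a degree map is presented by its set of morphisms alone, objects
  being identified with identity morphisms; thus range and source take morphisms to morphisms.
  The composite \<open>cmp \<Lambda> \<mu> \<nu>\<close>, written \<open>\<mu>\<nu>\<close> on paper, is meaningful only for
  \<open>src \<Lambda> \<mu> = rng \<Lambda> \<nu>\<close>.
\<close>

record 'a graded_category =
  Mor :: "'a set"
  rng :: "'a \<Rightarrow> 'a"
  src :: "'a \<Rightarrow> 'a"
  cmp :: "'a \<Rightarrow> 'a \<Rightarrow> 'a"
  deg :: "'a \<Rightarrow> (nat \<Rightarrow>\<^sub>0 nat)"

locale small_category =
  fixes \<Lambda> :: "('a, 'z) graded_category_scheme"
  assumes rng_closed: "\<xi> \<in> Mor \<Lambda> \<Longrightarrow> rng \<Lambda> \<xi> \<in> Mor \<Lambda>"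
    and src_closed: "\<xi> \<in> Mor \<Lambda> \<Longrightarrow> src \<Lambda> \<xi> \<in> Mor \<Lambda>"
    and rng_rng: "\<xi> \<in> Mor \<Lambda> \<Longrightarrow> rng \<Lambda> (rng \<Lambda> \<xi>) = rng \<Lambda> \<xi>"
    and src_rng: "\<xi> \<in> Mor \<Lambda> \<Longrightarrow> src \<Lambda> (rng \<Lambda> \<xi>) = rng \<Lambda> \<xi>"
    and rng_src: "\<xi> \<in> Mor \<Lambda> \<Longrightarrow> rng \<Lambda> (src \<Lambda> \<xi>) = src \<Lambda> \<xi>"
    and src_src: "\<xi> \<in> Mor \<Lambda> \<Longrightarrow> src \<Lambda> (src \<Lambda> \<xi>) = src \<Lambda> \<xi>"
    and comp_closed:
      "\<lbrakk>\<mu> \<in> Mor \<Lambda>; \<nu> \<in> Mor \<Lambda>; src \<Lambda> \<mu> = rng \<Lambda> \<nu>\<rbrakk> \<Longrightarrow> cmp \<Lambda> \<mu> \<nu> \<in> Mor \<Lambda>"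
    and rng_comp:
      "\<lbrakk>\<mu> \<in> Mor \<Lambda>; \<nu> \<in> Mor \<Lambda>; src \<Lambda> \<mu> = rng \<Lambda> \<nu>\<rbrakk> \<Longrightarrow> rng \<Lambda> (cmp \<Lambda> \<mu> \<nu>) = rng \<Lambda> \<mu>"
    and src_comp:
      "\<lbrakk>\<mu> \<in> Mor \<Lambda>; \<nu> \<in> Mor \<Lambda>; src \<Lambda> \<mu> = rng \<Lambda> \<nu>\<rbrakk> \<Longrightarrow> src \<Lambda> (cmp \<Lambda> \<mu> \<nu>) = src \<Lambda> \<nu>"
    and comp_assoc:
      "\<lbrakk>\<xi> \<in> Mor \<Lambda>; \<mu> \<in> Mor \<Lambda>; \<nu> \<in> Mor \<Lambda>; src \<Lambda> \<xi> = rng \<Lambda> \<mu>; src \<Lambda> \<mu> = rng \<Lambda> \<nu>\<rbrakk>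
        \<Longrightarrow> cmp \<Lambda> (cmp \<Lambda> \<xi> \<mu>) \<nu> = cmp \<Lambda> \<xi> (cmp \<Lambda> \<mu> \<nu>)"
    and comp_rng_left: "\<xi> \<in> Mor \<Lambda> \<Longrightarrow> cmp \<Lambda> (rng \<Lambda> \<xi>) \<xi> = \<xi>"
    and comp_src_right: "\<xi> \<in> Mor \<Lambda> \<Longrightarrow> cmp \<Lambda> \<xi> (src \<Lambda> \<xi>) = \<xi>"

definition objects :: "('a, 'z) graded_category_scheme \<Rightarrow> 'a set" where
  "objects \<Lambda> = {v \<in> Mor \<Lambda>. rng \<Lambda> v = v}"

text \<open>
  \<open>\<nat>\<^sup>k\<close> sits inside the finitely supported functions on \<open>nat\<close> as those supported in
  \<open>{1..k}\<close>; \<open>gen i\<close> is the generator \<open>\<epsilon>\<^sub>i\<close>.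
\<close>

definition Nk :: "nat \<Rightarrow> (nat \<Rightarrow>\<^sub>0 nat) set" where
  "Nk k = {m. Poly_Mapping.keys m \<subseteq> {1..k}}"

definition gen :: "nat \<Rightarrow> (nat \<Rightarrow>\<^sub>0 nat)" where
  "gen i = Poly_Mapping.single i 1"

locale k_graph = small_category \<Lambda>
  for k :: nat and \<Lambda> :: "('a, 'z) graded_category_scheme" +
  assumes countable_Mor: "countable (Mor \<Lambda>)"
    and deg_closed: "\<xi> \<in> Mor \<Lambda> \<Longrightarrow> deg \<Lambda> \<xi> \<in> Nk k"
    and deg_object: "v \<in> objects \<Lambda> \<Longrightarrow> deg \<Lambda> v = 0"
    and deg_comp:
      "\<lbrakk>\<mu> \<in> Mor \<Lambda>; \<nu> \<in> Mor \<Lambda>; src \<Lambda> \<mu> = rng \<Lambda> \<nu>\<rbrakk>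
        \<Longrightarrow> deg \<Lambda> (cmp \<Lambda> \<mu> \<nu>) = deg \<Lambda> \<mu> + deg \<Lambda> \<nu>"
    and factorisation:
      "\<lbrakk>\<xi> \<in> Mor \<Lambda>; m \<in> Nk k; n \<in> Nk k; deg \<Lambda> \<xi> = m + n\<rbrakk>
        \<Longrightarrow> \<exists>!p. case p of (\<mu>, \<nu>) \<Rightarrow>
              \<mu> \<in> Mor \<Lambda> \<and> \<nu> \<in> Mor \<Lambda> \<and> deg \<Lambda> \<mu> = m \<and> deg \<Lambda> \<nu> = n \<and>
              src \<Lambda> \<mu> = rng \<Lambda> \<nu> \<and> \<xi> = cmp \<Lambda> \<mu> \<nu>"

text \<open>\<open>\<Lambda>\<^sup>m = d\<^sup>-\<^sup>1(m)\<close>\<close>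

definition deg_fibre :: "('a, 'z) graded_category_scheme \<Rightarrow> (nat \<Rightarrow>\<^sub>0 nat) \<Rightarrow> 'a set" where
  "deg_fibre \<Lambda> m = {\<xi> \<in> Mor \<Lambda>. deg \<Lambda> \<xi> = m}"

text \<open>\<open>vF = r\<^sup>-\<^sup>1(v) \<inter> F\<close>\<close>

definition with_range :: "('a, 'z) graded_category_scheme \<Rightarrow> 'a \<Rightarrow> 'a set \<Rightarrow> 'a set" where
  "with_range \<Lambda> v F = {\<xi> \<in> Mor \<Lambda>. rng \<Lambda> \<xi> = v} \<inter> F"

definition colours :: "nat \<Rightarrow> ('a, 'z) graded_category_scheme \<Rightarrow> 'a \<Rightarrow> nat set" where
  "colours k \<Lambda> v = {i \<in> {1..k}. with_range \<Lambda> v (deg_fibre \<Lambda> (gen i)) \<noteq> {}}"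

text \<open>
  The factorisation property makes the identification of objects with the morphisms of degree
  zero a theorem.
\<close>

lemma (in k_graph) deg_fibre_0: "deg_fibre \<Lambda> 0 = objects \<Lambda>"
proof
  show "objects \<Lambda> \<subseteq> deg_fibre \<Lambda> 0"
    using deg_object by (auto simp: objects_def deg_fibre_def)
next
  show "deg_fibre \<Lambda> 0 \<subseteq> objects \<Lambda>"
  proof
    fix \<xi> assume "\<xi> \<in> deg_fibre \<Lambda> 0"
    then have l: "\<xi> \<in> Mor \<Lambda>" and d: "deg \<Lambda> \<xi> = 0" by (auto simp: deg_fibre_def)
    have r: "deg \<Lambda> (rng \<Lambda> \<xi>) = 0" and s: "deg \<Lambda> (src \<Lambda> \<xi>) = 0"
      using l deg_object rng_closed src_closed rng_rng rng_src by (auto simp: objects_def)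
    have z: "0 \<in> Nk k" by (simp add: Nk_def)
    have "(rng \<Lambda> \<xi>, \<xi>) = (\<xi>, src \<Lambda> \<xi>)"
      by (rule ex1E[OF factorisation[OF l z z]], simp add: d)
        (use l d r s rng_closed src_closed src_rng rng_src comp_rng_left comp_src_right in auto)
    then show "\<xi> \<in> objects \<Lambda>" using l by (simp add: objects_def)
  qed
qed

end

theory Submission
  imports Defs
begin

text \<open>
  If \<open>f\<close> is an edge of colour \<open>j\<close> with range \<open>s(e)\<close>, then the path \<open>ef\<close> has degree
  \<open>\<epsilon>\<^sub>i + \<epsilon>\<^sub>j = \<epsilon>\<^sub>j + \<epsilon>\<^sub>i\<close>. The factorisation property lets it start instead with an edge of
  colour \<open>j\<close>, whose range is \<open>r(ef) = r(e)\<close>. Colour \<open>i\<close> itself is witnessed by \<open>e\<close>.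
\<close>

lemma gen_in_Nk: "i \<in> {1..k} \<Longrightarrow> gen i \<in> Nk k"
  by (simp add: gen_def Nk_def)

lemma colours_iff:
  "j \<in> colours k \<Lambda> v \<longleftrightarrow>
    j \<in> {1..k} \<and> (\<exists>f \<in> Mor \<Lambda>. deg \<Lambda> f = gen j \<and> rng \<Lambda> f = v)"
  by (auto simp: colours_def with_range_def deg_fibre_def)

lemma (in k_graph) prefix_of_degree:
  assumes "\<xi> \<in> Mor \<Lambda>" "m \<in> Nk k" "n \<in> Nk k" "deg \<Lambda> \<xi> = m + n"
  obtains \<mu> where "\<mu> \<in> Mor \<Lambda>" "deg \<Lambda> \<mu> = m" "rng \<Lambda> \<mu> = rng \<Lambda> \<xi>"
proof -
  obtain \<mu> \<nu> where "\<mu> \<in> Mor \<Lambda>" "\<nu> \<in> Mor \<Lambda>" "deg \<Lambda> \<mu> = m"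
    "src \<Lambda> \<mu> = rng \<Lambda> \<nu>" "\<xi> = cmp \<Lambda> \<mu> \<nu>"
    using ex1_implies_ex[OF factorisation[OF assms]] by auto
  then show thesis
    using that rng_comp by simp
qed

theorem lemma3p4:
  fixes k i :: nat and \<Lambda> :: "'a graded_category" and e :: 'a
  assumes "k_graph k \<Lambda>"
    and "i \<in> {1..k}"
    and "e \<in> deg_fibre \<Lambda> (gen i)"
  shows "colours k \<Lambda> (rng \<Lambda> e) \<supseteq> {i} \<union> colours k \<Lambda> (src \<Lambda> e)"
proof -
  interpret k_graph k \<Lambda> by fact
  have e: "e \<in> Mor \<Lambda>" "deg \<Lambda> e = gen i"
    using assms(3) by (auto simp: deg_fibre_def)
  have "i \<in> colours k \<Lambda> (rng \<Lambda> e)"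
    using e assms(2) by (auto simp: colours_iff)
  moreover have "j \<in> colours k \<Lambda> (rng \<Lambda> e)" if "j \<in> colours k \<Lambda> (src \<Lambda> e)" for j
  proof -
    obtain f where f: "f \<in> Mor \<Lambda>" "deg \<Lambda> f = gen j" "rng \<Lambda> f = src \<Lambda> e"
      and j: "j \<in> {1..k}"
      using \<open>j \<in> colours k \<Lambda> (src \<Lambda> e)\<close> by (auto simp: colours_iff)
    have "deg \<Lambda> (cmp \<Lambda> e f) = gen j + gen i"
      using deg_comp e f by (simp add: add.commute)
    then obtain \<mu> where "\<mu> \<in> Mor \<Lambda>" "deg \<Lambda> \<mu> = gen j" "rng \<Lambda> \<mu> = rng \<Lambda> (cmp \<Lambda> e f)"
      using prefix_of_degree comp_closed gen_in_Nk e f j assms(2) by metis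
    then show ?thesis
      using rng_comp e f j by (auto simp: colours_iff)
  qed
  ultimately show ?thesis by blast
qed

end
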